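(* Let $s=(s_k)_{k\in\mathbb{N}}$ be a sequence of non-negative real numbers with $\sum_{k=1}^\infty s_k=\infty$. For $A\subset\mathbb{N}$ put $$d_s(A)=\limsup_{k\to\infty}\frac{\sum_{i\in A\cap\{1,\dots,k\}}s_i}{\sum_{i=1}^k s_i}.$$ Then the Erdős–Ulam filter $\mathcal{EU}^s=\{\mathbb{N}\setminus A : A\subset\mathbb{N},\ d_s(A)=0\}$ is conglomerated.
   Context: A filter on $\mathbb{N}$ is a non-empty collection of subsets of $\mathbb{N}$ not containing $\emptyset$, closed under finite intersections and supersets. It is free if it contains every subset with finite complement. For a filter $\mathfrak{F}$ put $\mathcal{I}(\mathfrak{F})=\{\mathbb{N}\setminus A : A\in\mathfrak{F}\}$ and $\mathfrak{G}(\mathfrak{F})=2^{\mathbb{N}}\setminus\mathcal{I}(\mathfrak{F})$, where $2^{\mathbb{N}}$ is the collection of all subsets of $\mathbb{N}$. A free filter $\mathfrak{F}$ on $\mathbb{N}$ is conglomerated if there is a sequence of pairwise disjoint sets $D_n\in\mathcal{I}(\mathfrak{F})$, $n\in\mathbb{N}$, such that $\bigcup_{n\in M}D_n\in\mathfrak{G}(\mathfrak{F})$ for every infinite subset $M\subset\mathbb{N}$. The quotient defining $d_s(A)$ is considered for all $k$ large enough that $\sum_{i=1}^k s_i>0$. *)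

theory Defs
  imports "HOL-Library.Extended_Real" "HOL-Library.Liminf_Limsup" "HOL-Library.Disjoint_Sets"
begin

abbreviation pos_nats :: "nat set" where
  "pos_nats \<equiv> {1..}"

text \<open>
  Filters are collections of subsets of the positive integers. Properness is part of the
  definition, unlike for the type \<^typ>\<open>nat filter\<close>; see \<open>is_filter_iff_eventually\<close> below.
\<close>
definition is_filter_on_pos :: "nat set set \<Rightarrow> bool" where
  "is_filter_on_pos F \<longleftrightarrow>
     F \<subseteq> Pow pos_nats \<and> F \<noteq> {} \<and> {} \<notin> F \<and>
     (\<forall>A\<in>F. \<forall>B\<in>F. A \<inter> B \<in> F) \<and>
     (\<forall>A\<in>F. \<forall>B. A \<subseteq> B \<and> B \<subseteq> pos_nats \<longrightarrow> B \<in> F)"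

lemma is_filter_iff_eventually:
  "is_filter_on_pos F \<longleftrightarrow>
     (\<exists>G. G \<noteq> bot \<and> G \<le> principal pos_nats \<and>
          F = {A. A \<subseteq> pos_nats \<and> eventually (\<lambda>x. x \<in> A) G})" (is "?L \<longleftrightarrow> ?R")
proof
  assume L: ?L
  define P where "P = (\<lambda>Q. {x \<in> pos_nats. Q x} \<in> F)"
  have top: "pos_nats \<in> F"
    using L unfolding is_filter_on_pos_def by blast
  have "Filter.is_filter P"
  proof
    show "P (\<lambda>x. True)" using top by (simp add: P_def atLeast_def)
  next
    fix Q R assume "P Q" "P R"
    then have "{x \<in> pos_nats. Q x} \<inter> {x \<in> pos_nats. R x} \<in> F"
      using L unfolding P_def is_filter_on_pos_def by blast
    moreover have "{x \<in> pos_nats. Q x} \<inter> {x \<in> pos_nats. R x} = {x \<in> pos_nats. Q x \<and> R x}"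
      by auto
    ultimately show "P (\<lambda>x. Q x \<and> R x)" by (simp add: P_def)
  next
    fix Q R :: "nat \<Rightarrow> bool" assume QR: "\<forall>x. Q x \<longrightarrow> R x" and "P Q"
    then have "{x \<in> pos_nats. Q x} \<in> F" by (simp add: P_def)
    moreover have "{x \<in> pos_nats. Q x} \<subseteq> {x \<in> pos_nats. R x}" using QR by auto
    moreover have "{x \<in> pos_nats. R x} \<subseteq> pos_nats" by auto
    ultimately show "P R" using L unfolding P_def is_filter_on_pos_def by meson
  qed
  then have ev: "eventually Q (Abs_filter P) \<longleftrightarrow> {x \<in> pos_nats. Q x} \<in> F" for Q
    by (simp add: eventually_Abs_filter P_def)
  have sub: "{x \<in> pos_nats. x \<in> A} = A" if "A \<subseteq> pos_nats" for A
    using that by blast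
  have "Abs_filter P \<noteq> bot"
    using L unfolding trivial_limit_def ev is_filter_on_pos_def by simp
  moreover have "Abs_filter P \<le> principal pos_nats"
    unfolding le_principal ev using top by (simp add: atLeast_def)
  moreover have "F = {A. A \<subseteq> pos_nats \<and> eventually (\<lambda>x. x \<in> A) (Abs_filter P)}"
    unfolding ev using L sub unfolding is_filter_on_pos_def by (smt (verit) Collect_cong Collect_mem_eq Pow_iff subset_iff)
  ultimately show ?R by blast
next
  assume ?R
  then obtain G where G: "G \<noteq> bot" "G \<le> principal pos_nats"
    and F: "F = {A. A \<subseteq> pos_nats \<and> eventually (\<lambda>x. x \<in> A) G}" by blast
  have "pos_nats \<in> F" using G(2) by (simp add: F le_principal)
  moreover have "{} \<notin> F" using G(1) by (simp add: F trivial_limit_def)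
  moreover have "A \<inter> B \<in> F" if "A \<in> F" "B \<in> F" for A B
    using that by (auto simp: F eventually_conj_iff)
  moreover have "B \<in> F" if "A \<in> F" "A \<subseteq> B" "B \<subseteq> pos_nats" for A B
    using that unfolding F by (auto elim: eventually_mono)
  ultimately show ?L unfolding is_filter_on_pos_def using F by blast
qed

definition is_free_filter :: "nat set set \<Rightarrow> bool" where
  "is_free_filter F \<longleftrightarrow>
     is_filter_on_pos F \<and> (\<forall>A. A \<subseteq> pos_nats \<and> finite (pos_nats - A) \<longrightarrow> A \<in> F)"

definition dual_ideal :: "nat set set \<Rightarrow> nat set set" where
  "dual_ideal F = {pos_nats - A | A. A \<in> F}"

definition grill :: "nat set set \<Rightarrow> nat set set" where
  "grill F = Pow pos_nats - dual_ideal F"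

definition conglomerated :: "nat set set \<Rightarrow> bool" where
  "conglomerated F \<longleftrightarrow>
     is_free_filter F \<and>
     (\<exists>D :: nat \<Rightarrow> nat set.
        (\<forall>n\<in>pos_nats. D n \<in> dual_ideal F) \<and>
        disjoint_family_on D pos_nats \<and>
        (\<forall>M. M \<subseteq> pos_nats \<and> infinite M \<longrightarrow> (\<Union>n\<in>M. D n) \<in> grill F))"

text \<open>
  The limit superior is taken in \<^typ>\<open>ereal\<close>. Quotients with zero denominator have the
  junk value 0; if the partial sums of \<open>s\<close> tend to infinity, there are only finitely
  many of them and they do not affect the limit superior.
\<close>
definition upper_density :: "(nat \<Rightarrow> real) \<Rightarrow> nat set \<Rightarrow> ereal" where
  "upper_density s A =
     limsup (\<lambda>k. ereal ((\<Sum>i\<in>A \<inter> {1..k}. s i) / (\<Sum>i=1..k. s i)))"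

definition erdos_ulam :: "(nat \<Rightarrow> real) \<Rightarrow> nat set set" where
  "erdos_ulam s = {pos_nats - A | A. A \<subseteq> pos_nats \<and> upper_density s A = 0}"

end

theory Submission
  imports Defs
begin

text \<open>
  Write \<open>S k\<close> for the partial sums of \<open>s\<close>. Since \<open>S\<close> tends to infinity, there are indices
  \<open>a 0 < a 1 < \<dots>\<close> along which \<open>S\<close> at least doubles from one to the next. The finite blocks
  \<open>{a n<..a (Suc n)}\<close> then witness that the Erdos-Ulam filter is conglomerated. Each block is
  finite, and finite sets have density zero because \<open>S\<close> tends to infinity. On the other hand, a block
  carries at least half of the whole weight accumulated up to its right end
  (\<open>doubling_block_proportion\<close>), so a set that contains infinitely many blocks has proportion
  at least \<open>1/2\<close> infinitely often, and its upper density is positive.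

  All arguments about densities use that the proportions are non-negative, so that an upper
  density is zero exactly if the proportions converge to zero
  (\<open>upper_density_eq_0_iff\<close>). This makes the sets of density zero an ideal and avoids arithmetic
  in the extended reals.
\<close>

section \<open>Sets of density zero\<close>

definition proportion :: "(nat \<Rightarrow> real) \<Rightarrow> nat set \<Rightarrow> nat \<Rightarrow> real" where
  "proportion s A k = (\<Sum>i\<in>A \<inter> {1..k}. s i) / (\<Sum>i=1..k. s i)"

lemma erdos_ulam_iff:
  "B \<in> erdos_ulam s \<longleftrightarrow> B \<subseteq> pos_nats \<and> upper_density s (pos_nats - B) = 0"
proof
  assume "B \<in> erdos_ulam s"
  then obtain A where "A \<subseteq> pos_nats" "upper_density s A = 0" "B = pos_nats - A"
    unfolding erdos_ulam_def by blast
  then show "B \<subseteq> pos_nats \<and> upper_density s (pos_nats - B) = 0"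
    by (simp add: double_diff)
next
  assume B: "B \<subseteq> pos_nats \<and> upper_density s (pos_nats - B) = 0"
  then have "B = pos_nats - (pos_nats - B)"
    by (simp add: double_diff)
  with B show "B \<in> erdos_ulam s"
    unfolding erdos_ulam_def by blast
qed

lemma dual_ideal_erdos_ulam_iff:
  "A \<in> dual_ideal (erdos_ulam s) \<longleftrightarrow> A \<subseteq> pos_nats \<and> upper_density s A = 0"
proof
  assume "A \<in> dual_ideal (erdos_ulam s)"
  then obtain B where "B \<in> erdos_ulam s" "A = pos_nats - B"
    unfolding dual_ideal_def by blast
  then show "A \<subseteq> pos_nats \<and> upper_density s A = 0"
    by (simp add: erdos_ulam_iff)
next
  assume A: "A \<subseteq> pos_nats \<and> upper_density s A = 0"
  then have "A = pos_nats - (pos_nats - A)"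
    by (simp add: double_diff)
  moreover have "pos_nats - A \<in> erdos_ulam s"
    unfolding erdos_ulam_def using A by blast
  ultimately show "A \<in> dual_ideal (erdos_ulam s)"
    unfolding dual_ideal_def by blast
qed

context
  fixes s :: "nat \<Rightarrow> real"
  assumes nonneg: "\<And>k. k \<ge> 1 \<Longrightarrow> s k \<ge> 0"
begin

lemma partial_sum_nonneg: "(\<Sum>i\<in>A \<inter> {1..k}. s i) \<ge> 0"
  by (rule sum_nonneg) (auto intro: nonneg)

lemma proportion_nonneg: "proportion s A k \<ge> 0"
  unfolding proportion_def
  using partial_sum_nonneg[of A k] partial_sum_nonneg[of UNIV k] by simp

lemma proportion_mono:
  assumes "A \<inter> pos_nats \<subseteq> B"
  shows "proportion s A k \<le> proportion s B k"
proof -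
  have "(\<Sum>i\<in>A \<inter> {1..k}. s i) \<le> (\<Sum>i\<in>B \<inter> {1..k}. s i)"
    using assms by (intro sum_mono2) (auto intro: nonneg)
  then show ?thesis
    unfolding proportion_def
    using partial_sum_nonneg[of UNIV k] by (simp add: divide_right_mono)
qed

lemma proportion_Un_le: "proportion s (A \<union> B) k \<le> proportion s A k + proportion s B k"
proof -
  have "(\<Sum>i\<in>(A \<union> B) \<inter> {1..k}. s i) + (\<Sum>i\<in>A \<inter> B \<inter> {1..k}. s i)
      = (\<Sum>i\<in>A \<inter> {1..k}. s i) + (\<Sum>i\<in>B \<inter> {1..k}. s i)"
    using sum.union_inter[of "A \<inter> {1..k}" "B \<inter> {1..k}" s]
    by (simp add: Int_Un_distrib2 Int_ac)
  then have "(\<Sum>i\<in>(A \<union> B) \<inter> {1..k}. s i)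
      \<le> (\<Sum>i\<in>A \<inter> {1..k}. s i) + (\<Sum>i\<in>B \<inter> {1..k}. s i)"
    using partial_sum_nonneg[of "A \<inter> B" k] by linarith
  then show ?thesis
    unfolding proportion_def add_divide_distrib[symmetric]
    using partial_sum_nonneg[of UNIV k] by (simp add: divide_right_mono)
qed

lemma upper_density_eq_0_iff: "upper_density s A = 0 \<longleftrightarrow> proportion s A \<longlonglongrightarrow> 0"
proof -
  let ?f = "\<lambda>k. ereal (proportion s A k)"
  have "limsup ?f = 0 \<longleftrightarrow> ?f \<longlonglongrightarrow> 0"
  proof
    assume limsup: "limsup ?f = 0"
    have "liminf ?f \<ge> 0"
      by (rule Liminf_bounded) (simp add: proportion_nonneg)
    moreover have "liminf ?f \<le> limsup ?f"
      by (rule Liminf_le_Limsup) simp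
    ultimately have "liminf ?f = 0"
      using limsup by simp
    then show "?f \<longlonglongrightarrow> 0"
      using limsup by (intro Liminf_eq_Limsup) simp_all
  qed (simp add: lim_imp_Limsup)
  then show ?thesis
    by (simp add: upper_density_def proportion_def[abs_def] zero_ereal_def)
qed

lemma upper_density_eq_0I:
  assumes "\<And>k. proportion s A k \<le> g k" and "g \<longlonglongrightarrow> 0"
  shows "upper_density s A = 0"
proof -
  have "proportion s A \<longlonglongrightarrow> 0"
    by (rule tendsto_sandwich[OF _ _ tendsto_const assms(2)])
       (simp_all add: proportion_nonneg assms(1))
  then show ?thesis
    by (simp add: upper_density_eq_0_iff)
qed

lemma upper_density_eq_0_mono:
  assumes "upper_density s B = 0" and "A \<inter> pos_nats \<subseteq> B"
  shows "upper_density s A = 0"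
proof (rule upper_density_eq_0I)
  show "proportion s A k \<le> proportion s B k" for k
    using assms(2) by (rule proportion_mono)
  show "proportion s B \<longlonglongrightarrow> 0"
    using assms(1) by (simp add: upper_density_eq_0_iff)
qed

lemma upper_density_eq_0_Un:
  assumes "upper_density s A = 0" and "upper_density s B = 0"
  shows "upper_density s (A \<union> B) = 0"
proof (rule upper_density_eq_0I)
  show "proportion s (A \<union> B) k \<le> proportion s A k + proportion s B k" for k
    by (rule proportion_Un_le)
  show "(\<lambda>k. proportion s A k + proportion s B k) \<longlonglongrightarrow> 0"
    using assms tendsto_add[of "proportion s A" 0 sequentially "proportion s B" 0]
    by (simp add: upper_density_eq_0_iff)
qed

section \<open>Blocks on which the partial sums double\<close>

text \<open>
  The weight in front of the block, up to \<open>m\<close>, is at most half of the weight up to \<open>n\<close>; the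
  block carries at least the remaining half.
\<close>
lemma doubling_block_proportion:
  assumes "m \<le> n"
    and "2 * (\<Sum>i=1..m. s i) \<le> (\<Sum>i=1..n. s i)" and "(\<Sum>i=1..n. s i) > 0"
    and "{m<..n} \<subseteq> A"
  shows "proportion s A n \<ge> 1 / 2"
proof -
  have "{1..n} = {1..m} \<union> {m<..n}"
    using assms(1) by auto
  moreover have "{1..m} \<inter> {m<..n} = {}"
    by auto
  ultimately have "(\<Sum>i=1..n. s i) = (\<Sum>i=1..m. s i) + (\<Sum>i\<in>{m<..n}. s i)"
    by (simp only: sum.union_disjoint finite_atLeastAtMost finite_greaterThanAtMost)
  moreover have "{m<..n} \<inter> {1..n} = {m<..n}"
    by auto
  ultimately have "proportion s {m<..n} n \<ge> 1 / 2"
    using assms(2,3) by (simp add: proportion_def field_simps)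
  also have "proportion s {m<..n} n \<le> proportion s A n"
    using assms(4) by (intro proportion_mono) auto
  finally show ?thesis .
qed

lemma infinitely_many_doubling_blocks:
  assumes a: "strict_mono a"
    and double: "\<And>n. (\<Sum>i=1..a (Suc n). s i) \<ge> 2 * (\<Sum>i=1..a n. s i) + 1"
    and "infinite M"
  shows "upper_density s (\<Union>n\<in>M. {a n<..a (Suc n)}) \<noteq> 0"
proof
  let ?U = "\<Union>n\<in>M. {a n<..a (Suc n)}"
  assume "upper_density s ?U = 0"
  then have "proportion s ?U \<longlonglongrightarrow> 0"
    by (simp add: upper_density_eq_0_iff)
  then have "\<forall>\<^sub>F k in sequentially. proportion s ?U k < 1 / 2"
    by (rule order_tendstoD) simp
  then obtain N where N: "\<And>k. k \<ge> N \<Longrightarrow> proportion s ?U k < 1 / 2"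
    by (auto simp: eventually_sequentially)
  obtain n where n: "n \<in> M" "n \<ge> N"
    using \<open>infinite M\<close> by (meson infinite_nat_iff_unbounded_le)
  have "proportion s ?U (a (Suc n)) \<ge> 1 / 2"
  proof (rule doubling_block_proportion)
    show "a n \<le> a (Suc n)"
      using a by (simp add: strict_mono_less_eq)
    show "2 * (\<Sum>i=1..a n. s i) \<le> (\<Sum>i=1..a (Suc n). s i)"
      using double[of n] by simp
    show "(\<Sum>i=1..a (Suc n). s i) > 0"
      using double[of n] partial_sum_nonneg[of UNIV "a n"] by simp
    show "{a n<..a (Suc n)} \<subseteq> ?U"
      using n(1) by blast
  qed
  moreover have "a (Suc n) \<ge> N"
    using strict_mono_imp_increasing[OF a, of "Suc n"] n(2) by simp
  ultimately show False
    using N[of "a (Suc n)"] by simp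
qed

section \<open>Divergent weights\<close>

context
  assumes diverges: "filterlim (\<lambda>n. \<Sum>k=1..n. s k) at_top sequentially"
begin

text \<open>
  The numerator is bounded by the total weight of \<open>A\<close>, while the denominator tends to
  infinity.
\<close>
lemma finite_imp_upper_density_eq_0:
  assumes "finite A"
  shows "upper_density s A = 0"
proof (rule upper_density_eq_0I)
  let ?c = "\<Sum>i\<in>A \<inter> pos_nats. s i"
  show "proportion s A k \<le> ?c / (\<Sum>i=1..k. s i)" for k
  proof -
    have "(\<Sum>i\<in>A \<inter> {1..k}. s i) \<le> ?c"
      using assms by (intro sum_mono2) (auto intro: nonneg)
    then show ?thesis
      unfolding proportion_def
      using partial_sum_nonneg[of UNIV k] by (simp add: divide_right_mono)
  qed
  show "(\<lambda>k. ?c / (\<Sum>i=1..k. s i)) \<longlonglongrightarrow> 0"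
    by (rule tendsto_divide_0[OF tendsto_const filterlim_at_top_imp_at_infinity[OF diverges]])
qed

lemma upper_density_pos_nats_neq_0: "upper_density s pos_nats \<noteq> 0"
proof
  assume "upper_density s pos_nats = 0"
  then have "proportion s pos_nats \<longlonglongrightarrow> 0"
    by (simp add: upper_density_eq_0_iff)
  then have "\<forall>\<^sub>F k in sequentially. proportion s pos_nats k < 1"
    by (rule order_tendstoD) simp
  moreover have "\<forall>\<^sub>F k in sequentially. (\<Sum>i=1..k. s i) > 0"
    using diverges by (simp add: filterlim_at_top_dense)
  ultimately have "\<forall>\<^sub>F k in sequentially. False"
  proof eventually_elim
    case (elim k)
    have "pos_nats \<inter> {1..k} = {1..k}"
      by auto
    with elim show False
      by (simp add: proportion_def)
  qed
  then show False
    by simp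
qed

lemma is_free_filter_erdos_ulam: "is_free_filter (erdos_ulam s)"
  unfolding is_free_filter_def is_filter_on_pos_def
proof (intro conjI ballI allI impI)
  show "erdos_ulam s \<subseteq> Pow pos_nats"
    by (auto simp: erdos_ulam_iff)
  show cofinite: "A \<in> erdos_ulam s" if "A \<subseteq> pos_nats \<and> finite (pos_nats - A)" for A
    using that by (simp add: erdos_ulam_iff finite_imp_upper_density_eq_0)
  have "pos_nats \<in> erdos_ulam s"
    by (rule cofinite) simp
  then show "erdos_ulam s \<noteq> {}"
    by blast
  show "{} \<notin> erdos_ulam s"
    using upper_density_pos_nats_neq_0 by (simp add: erdos_ulam_iff)
  show "A \<inter> B \<in> erdos_ulam s" if "A \<in> erdos_ulam s" "B \<in> erdos_ulam s" for A B
    using that upper_density_eq_0_Un[of "pos_nats - A" "pos_nats - B"]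
    by (auto simp: erdos_ulam_iff Diff_Int)
  show "B \<in> erdos_ulam s" if "A \<in> erdos_ulam s" "A \<subseteq> B \<and> B \<subseteq> pos_nats" for A B
    using that upper_density_eq_0_mono[of "pos_nats - A" "pos_nats - B"]
    by (auto simp: erdos_ulam_iff)
qed

text \<open>
  The summand \<open>1\<close> makes the partial sum at every right end of a block positive, so that the
  proportions there are genuine quotients.
\<close>
lemma doubling_indices:
  obtains a :: "nat \<Rightarrow> nat" where "strict_mono a"
    and "\<And>n. (\<Sum>i=1..a (Suc n). s i) \<ge> 2 * (\<Sum>i=1..a n. s i) + 1"
proof -
  have "\<exists>m>x. (\<Sum>i=1..m. s i) \<ge> 2 * (\<Sum>i=1..x. s i) + 1" for x
  proof -
    have "\<forall>\<^sub>F m in sequentially. m > x \<and> (\<Sum>i=1..m. s i) \<ge> 2 * (\<Sum>i=1..x. s i) + 1"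
      using diverges by (intro eventually_conj eventually_gt_at_top) (simp add: filterlim_at_top)
    then show ?thesis
      by (rule eventually_happens'[rotated]) simp
  qed
  then have "\<exists>a. \<forall>n. True \<and> a n < a (Suc n) \<and>
      (\<Sum>i=1..a (Suc n). s i) \<ge> 2 * (\<Sum>i=1..a n. s i) + 1"
    by (intro dependent_nat_choice) auto
  then show thesis
    using that by (auto simp: strict_mono_Suc_iff)
qed

lemma conglomerated_erdos_ulam: "conglomerated (erdos_ulam s)"
proof -
  obtain a :: "nat \<Rightarrow> nat" where a: "strict_mono a"
    and double: "\<And>n. (\<Sum>i=1..a (Suc n). s i) \<ge> 2 * (\<Sum>i=1..a n. s i) + 1"
    using doubling_indices by blast
  define D where "D n = {a n<..a (Suc n)}" for n
  have pos: "D n \<subseteq> pos_nats" for n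
    by (auto simp: D_def)
  have "D n \<in> dual_ideal (erdos_ulam s)" for n
    using pos[of n] by (simp add: dual_ideal_erdos_ulam_iff D_def finite_imp_upper_density_eq_0)
  moreover have "disjoint_family_on D pos_nats"
  proof -
    have disjoint: "D m \<inter> D n = {}" if "m < n" for m n
    proof -
      have "a (Suc m) \<le> a n"
        using a that by (simp add: strict_mono_less_eq)
      then show ?thesis
        by (auto simp: D_def)
    qed
    show ?thesis
      unfolding disjoint_family_on_def using disjoint by (metis Int_commute nat_neq_iff)
  qed
  moreover have "(\<Union>n\<in>M. D n) \<in> grill (erdos_ulam s)" if "infinite M" for M
    using infinitely_many_doubling_blocks[OF a double that] pos
    by (auto simp: grill_def dual_ideal_erdos_ulam_iff D_def)
  ultimately show ?thesis
    unfolding conglomerated_def using is_free_filter_erdos_ulam by blast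
qed

end

end

theorem theorem2p7:
  fixes s :: "nat \<Rightarrow> real"
  assumes nonneg: "\<And>k. k \<ge> 1 \<Longrightarrow> s k \<ge> 0"
    and diverges: "filterlim (\<lambda>n. \<Sum>k=1..n. s k) at_top sequentially"
  shows "conglomerated (erdos_ulam s)"
  using nonneg diverges by (rule conglomerated_erdos_ulam)

end
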